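(* Let $A\in\mathbb{R}^{m\times n}$, $b\in\mathbb{R}^m$, and let $\tau,\sigma>0$ be constants. Define $H_{1,\sigma},\tilde H_{1,\sigma},\hat H_{1,\sigma}:\mathbb{R}^n\to\mathbb{R}$ by $$H_{1,\sigma}(x)=\|Ax-b\|_2^2+2\tau\sum_{k=1}^n\left(x_k\operatorname{erf}\left(\frac{x_k}{\sqrt2\,\sigma}\right)+\sqrt{\frac{2}{\pi}}\,\sigma\exp\left(-\frac{x_k^2}{2\sigma^2}\right)\right),$$ $$\tilde H_{1,\sigma}(x)=\|Ax-b\|_2^2+2\tau\sum_{k=1}^n\left(x_k\operatorname{erf}\left(\frac{x_k}{\sqrt2\,\sigma}\right)+\sqrt{\frac{2}{\pi}}\,\sigma\exp\left(-\frac{x_k^2}{2\sigma^2}\right)-\sqrt{\frac{2}{\pi}}\,\sigma\right),$$ $$\hat H_{1,\sigma}(x)=\|Ax-b\|_2^2+2\tau\sum_{k=1}^n x_k\operatorname{erf}\left(\frac{x_k}{\sqrt2\,\sigma}\right).$$ Then for all $x\in\mathbb{R}^n$ the gradients are given by $$\nabla H_{1,\sigma}(x)=\nabla\tilde H_{1,\sigma}(x)=2A^T(Ax-b)+2\tau\left\{\operatorname{erf}\left(\frac{x_k}{\sqrt2\,\sigma}\right)\right\}_{k=1}^n,$$ $$\nabla\hat H_{1,\sigma}(x)=2A^T(Ax-b)+2\tau\left\{\operatorname{erf}\left(\frac{x_k}{\sqrt2\,\sigma}\right)+x_k\frac{1}{\sigma}\sqrt{\frac{2}{\pi}}\exp\left(-\frac{x_k^2}{2\sigma^2}\right)\right\}_{k=1}^n,$$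 and the Hessians by $$\nabla^2H_{1,\sigma}(x)=\nabla^2\tilde H_{1,\sigma}(x)=2A^TA+\frac{2\sqrt2\,\tau}{\sigma\sqrt\pi}\operatorname{Diag}\left(\exp\left(-\frac{x_k^2}{2\sigma^2}\right)\right),$$ $$\nabla^2\hat H_{1,\sigma}(x)=2A^TA+\frac{4\sqrt2\,\tau}{\sigma\sqrt\pi}\operatorname{Diag}\left(\exp\left(-\frac{x_k^2}{2\sigma^2}\right)-\frac{x_k^2}{2\sigma^2}\exp\left(-\frac{x_k^2}{2\sigma^2}\right)\right).$$
   Context: The error function is $\operatorname{erf}(t)=\frac{2}{\sqrt\pi}\int_0^t\exp(-u^2)\,\mathrm{d}u$ for $t\in\mathbb{R}$. $\|\cdot\|_2$ is the Euclidean norm. $\{a_k\}_{k=1}^n$ denotes the (column) vector in $\mathbb{R}^n$ with $k$-th entry $a_k$. $\operatorname{Diag}:\mathbb{R}^n\to\mathbb{R}^{n\times n}$ sends a vector to the diagonal matrix with that vector's entries on the diagonal; $\operatorname{Diag}(a_k)$ denotes the diagonal matrix with entries $a_1,\dots,a_n$. *)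

theory Defs
  imports "HOL-Analysis.Analysis"
begin

text \<open>The oriented interval integral changes sign when its limits are swapped, so the
  formula below is also the intended one for negative \<open>t\<close>.\<close>

definition erf :: "real \<Rightarrow> real" where
  "erf t = 2 / sqrt pi * (LBINT u=ereal 0..ereal t. exp (- (u\<^sup>2)))"

definition Diag :: "real ^ 'n \<Rightarrow> real ^ 'n ^ 'n" where
  "Diag a = (\<chi> i j. if i = j then a $ i else 0)"

text \<open>The Hessian at \<open>x\<close> is the Jacobian matrix at \<open>x\<close> of the gradient field \<open>g\<close>, which is
  required to exist near \<open>x\<close>. So \<open>M $ i $ j\<close> is the partial derivative in direction \<open>j\<close> of
  the \<open>i\<close>-th component of the gradient, and \<open>M\<close> is uniquely determined.\<close>

definition has_hessian :: "(real ^ 'n \<Rightarrow> real) \<Rightarrow> real ^ 'n ^ 'n \<Rightarrow> real ^ 'n \<Rightarrow> bool" where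
  "has_hessian f M x \<longleftrightarrow>
     (\<exists>g. (\<forall>\<^sub>F y in nhds x. GDERIV f y :> g y) \<and> (g has_derivative (\<lambda>h. M *v h)) (at x))"

lemma has_hessian_unique:
  assumes "has_hessian f M x" "has_hessian f N x"
  shows "M = N"
proof -
  obtain g where g: "\<forall>\<^sub>F y in nhds x. GDERIV f y :> g y" "(g has_derivative (\<lambda>h. M *v h)) (at x)"
    using assms(1) unfolding has_hessian_def by blast
  obtain g' where g': "\<forall>\<^sub>F y in nhds x. GDERIV f y :> g' y" "(g' has_derivative (\<lambda>h. N *v h)) (at x)"
    using assms(2) unfolding has_hessian_def by blast
  have "\<forall>\<^sub>F y in nhds x. g y = g' y"
    using g(1) g'(1)
  proof eventually_elim
    case (elim y)
    then have "(\<lambda>h. h \<bullet> g y) = (\<lambda>h. h \<bullet> g' y)"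
      unfolding gderiv_def by (rule has_derivative_unique)
    then show ?case
      by (metis inner_commute vector_eq_rdot)
  qed
  then have "\<forall>\<^sub>F y in at x. g y = g' y" "g x = g' x"
    using eventually_nhds_x_imp_x by (auto simp: eventually_at_filter elim: eventually_mono)
  then have "(g' has_derivative (\<lambda>h. M *v h)) (at x)"
    using has_derivative_transform_eventually[OF g(2)] by simp
  then have "(\<lambda>h. M *v h) = (\<lambda>h. N *v h)"
    using g'(2) by (rule has_derivative_unique)
  then show ?thesis
    by (metis matrix_of_matrix_vector_mul)
qed

definition H1 :: "real ^ 'n ^ 'm \<Rightarrow> real ^ 'm \<Rightarrow> real \<Rightarrow> real \<Rightarrow> real ^ 'n \<Rightarrow> real" where
  "H1 A b \<tau> \<sigma> x = (norm (A *v x - b))\<^sup>2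
     + 2 * \<tau> * (\<Sum>k\<in>UNIV. x $ k * erf (x $ k / (sqrt 2 * \<sigma>))
                 + sqrt (2 / pi) * \<sigma> * exp (- ((x $ k)\<^sup>2 / (2 * \<sigma>\<^sup>2))))"

definition H1_tilde :: "real ^ 'n ^ 'm \<Rightarrow> real ^ 'm \<Rightarrow> real \<Rightarrow> real \<Rightarrow> real ^ 'n \<Rightarrow> real" where
  "H1_tilde A b \<tau> \<sigma> x = (norm (A *v x - b))\<^sup>2
     + 2 * \<tau> * (\<Sum>k\<in>UNIV. x $ k * erf (x $ k / (sqrt 2 * \<sigma>))
                 + sqrt (2 / pi) * \<sigma> * exp (- ((x $ k)\<^sup>2 / (2 * \<sigma>\<^sup>2)))
                 - sqrt (2 / pi) * \<sigma>)"

definition H1_hat :: "real ^ 'n ^ 'm \<Rightarrow> real ^ 'm \<Rightarrow> real \<Rightarrow> real \<Rightarrow> real ^ 'n \<Rightarrow> real" where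
  "H1_hat A b \<tau> \<sigma> x = (norm (A *v x - b))\<^sup>2
     + 2 * \<tau> * (\<Sum>k\<in>UNIV. x $ k * erf (x $ k / (sqrt 2 * \<sigma>)))"

end

theory Submission
  imports Defs
begin

text \<open>
  All three functions have the form \<open>x \<mapsto> \<parallel>A x - b\<parallel>\<^sup>2 + c (\<Sum>k. \<phi> (x\<^sub>k))\<close> with a smooth scalar
  function \<open>\<phi>\<close>. The penalty is separable, so its gradient is \<open>c \<phi>' (x\<^sub>k)\<close> entrywise and its
  Hessian is diagonal with entries \<open>c \<phi>'' (x\<^sub>k)\<close>, while the quadratic term contributes
  \<open>2 A\<^sup>T (A x - b)\<close> and \<open>2 A\<^sup>T A\<close> (\<open>gderiv_least_squares_separable\<close>,
  \<open>has_hessian_least_squares_separable\<close>). What remains is calculus in one variable.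

  The fundamental theorem of calculus gives \<open>erf' t = 2 / \<surd>\<pi> exp (-t\<^sup>2)\<close>, hence
  \<open>d/dt erf (t / (\<surd>2 \<sigma>)) = (1/\<sigma>) \<surd>(2/\<pi>) exp (-t\<^sup>2 / (2 \<sigma>\<^sup>2))\<close>. Write \<open>G t\<close> for this Gaussian.
  Since \<open>G' t = -(t / \<sigma>\<^sup>2) G t\<close>, the exponential summand \<open>\<sigma>\<^sup>2 G t\<close> of the penalty has
  derivative \<open>-t G t\<close>. It cancels the second term of the product rule for
  \<open>t erf (t / (\<surd>2 \<sigma>))\<close>, so that \<open>\<phi>'\<close> is just the scaled error function; a constant
  subtracted from \<open>\<phi>\<close> changes nothing. Without the exponential summand the term \<open>t G t\<close>
  survives in \<open>\<phi>'\<close>, and \<open>\<phi>'' t = 2 G t - (t\<^sup>2 / \<sigma>\<^sup>2) G t\<close>.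
\<close>

lemma has_real_derivative_erf:
  "(erf has_real_derivative 2 / sqrt pi * exp (- (t\<^sup>2))) (at t)"
proof -
  \<comment> \<open>an interval that contains \<open>0\<close> and has \<open>t\<close> in its interior\<close>
  define a b where "a = - \<bar>t\<bar> - 1" and "b = \<bar>t\<bar> + 1"
  have "((\<lambda>s. LBINT u=ereal 0..ereal s. exp (- (u\<^sup>2))) has_vector_derivative exp (- (t\<^sup>2)))
          (at t within {a..b})"
    by (rule interval_integral_FTC2) (auto simp: a_def b_def intro!: continuous_intros)
  moreover have "at t within {a..b} = at t"
    by (rule at_within_interior) (auto simp: a_def b_def)
  ultimately have "((\<lambda>s. LBINT u=ereal 0..ereal s. exp (- (u\<^sup>2))) has_real_derivative exp (- (t\<^sup>2)))
          (at t)"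
    by (simp add: has_real_derivative_iff_has_vector_derivative)
  then have "((\<lambda>s. 2 / sqrt pi * (LBINT u=ereal 0..ereal s. exp (- (u\<^sup>2))))
               has_real_derivative 2 / sqrt pi * exp (- (t\<^sup>2))) (at t)"
    by (rule DERIV_cmult)
  moreover have "erf = (\<lambda>s. 2 / sqrt pi * (LBINT u=ereal 0..ereal s. exp (- (u\<^sup>2))))"
    by (rule ext) (rule erf_def)
  ultimately show ?thesis
    by simp
qed

lemma has_real_derivative_erf_scaled:
  assumes "\<sigma> > 0"
  shows "((\<lambda>t. erf (t / (sqrt 2 * \<sigma>))) has_real_derivative
           (1 / \<sigma>) * sqrt (2 / pi) * exp (- (t\<^sup>2 / (2 * \<sigma>\<^sup>2)))) (at t)"
proof -
  have "((\<lambda>t. t / (sqrt 2 * \<sigma>)) has_real_derivative 1 / (sqrt 2 * \<sigma>)) (at t)"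
    by (rule DERIV_cdivide) (rule DERIV_ident)
  from DERIV_chain2[OF has_real_derivative_erf this]
  have "((\<lambda>t. erf (t / (sqrt 2 * \<sigma>))) has_real_derivative
           2 / sqrt pi * exp (- ((t / (sqrt 2 * \<sigma>))\<^sup>2)) * (1 / (sqrt 2 * \<sigma>))) (at t)" .
  moreover have "2 / sqrt pi * (1 / (sqrt 2 * \<sigma>)) = (1 / \<sigma>) * sqrt (2 / pi)"
    using assms by (simp add: real_sqrt_divide field_simps)
  moreover have "(t / (sqrt 2 * \<sigma>))\<^sup>2 = t\<^sup>2 / (2 * \<sigma>\<^sup>2)"
    by (simp add: power_divide power_mult_distrib)
  ultimately show ?thesis
    by (metis (no_types, lifting) mult.assoc mult.commute)
qed

lemma has_real_derivative_gaussian: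
  assumes "\<sigma> > 0"
  shows "((\<lambda>t. exp (- (t\<^sup>2 / (2 * \<sigma>\<^sup>2)))) has_real_derivative
           - (t / \<sigma>\<^sup>2) * exp (- (t\<^sup>2 / (2 * \<sigma>\<^sup>2)))) (at t)"
  using assms by (auto intro!: derivative_eq_intros simp: field_simps)

lemma has_real_derivative_erf_penalty:
  assumes "\<sigma> > 0"
  shows "((\<lambda>t. t * erf (t / (sqrt 2 * \<sigma>))) has_real_derivative
           erf (t / (sqrt 2 * \<sigma>))
           + t * (1 / \<sigma>) * sqrt (2 / pi) * exp (- (t\<^sup>2 / (2 * \<sigma>\<^sup>2)))) (at t)"
  using DERIV_mult[OF DERIV_ident has_real_derivative_erf_scaled[OF assms], of t]
  by (simp add: algebra_simps)

text \<open>The smooth approximation of \<open>\<bar>t\<bar>\<close> has the smooth approximation of \<open>sgn t\<close> as its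
  derivative: the exponential summand is chosen so that its derivative cancels the remainder
  of the product rule.\<close>

lemma has_real_derivative_smoothed_abs:
  assumes "\<sigma> > 0"
  shows "((\<lambda>t. t * erf (t / (sqrt 2 * \<sigma>)) + sqrt (2 / pi) * \<sigma> * exp (- (t\<^sup>2 / (2 * \<sigma>\<^sup>2))))
           has_real_derivative erf (t / (sqrt 2 * \<sigma>))) (at t)"
proof -
  have cancel: "t * (1 / \<sigma>) * r * e + r * \<sigma> * (- (t / \<sigma>\<^sup>2) * e) = 0" for r e
    using assms by (simp add: field_simps power2_eq_square)
  show ?thesis
    using DERIV_add[OF has_real_derivative_erf_penalty[OF assms]
        DERIV_cmult[OF has_real_derivative_gaussian[OF assms], of "sqrt (2 / pi) * \<sigma>"], of t]
    by (simp only: add.assoc cancel add_0_right)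
qed

lemma second_derivative_erf_penalty:
  assumes "\<sigma> > 0"
  shows "((\<lambda>t. erf (t / (sqrt 2 * \<sigma>))
               + t * (1 / \<sigma>) * sqrt (2 / pi) * exp (- (t\<^sup>2 / (2 * \<sigma>\<^sup>2))))
           has_real_derivative
             2 * ((1 / \<sigma>) * sqrt (2 / pi))
             * (exp (- (t\<^sup>2 / (2 * \<sigma>\<^sup>2))) - t\<^sup>2 / (2 * \<sigma>\<^sup>2) * exp (- (t\<^sup>2 / (2 * \<sigma>\<^sup>2))))) (at t)"
proof -
  have "((\<lambda>t. t * (1 / \<sigma>) * sqrt (2 / pi)) has_real_derivative (1 / \<sigma>) * sqrt (2 / pi)) (at t)"
    using assms by (auto intro!: derivative_eq_intros)
  from DERIV_add[OF has_real_derivative_erf_scaled[OF assms]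
      DERIV_mult[OF this has_real_derivative_gaussian[OF assms]]]
  show ?thesis
    by (rule DERIV_cong) (use assms in \<open>auto simp: field_simps power2_eq_square\<close>)
qed

lemma has_derivative_component_compose:
  fixes x :: "real ^ 'n"
  assumes "(\<phi> has_real_derivative d) (at (x $ k))"
  shows "((\<lambda>x. \<phi> (x $ k)) has_derivative (\<lambda>h. d * h $ k)) (at x)"
  using has_derivative_compose[OF bounded_linear_imp_has_derivative[OF bounded_linear_vec_nth]
      assms[unfolded has_field_derivative_def]] by simp

lemma has_derivative_residual:
  fixes A :: "real ^ 'n ^ 'm"
  shows "((\<lambda>x. A *v x - b) has_derivative (\<lambda>h. A *v h)) (at x)"
  by (auto intro!: derivative_eq_intros bounded_linear_imp_has_derivative)

text \<open>The derivative of the inner product of the residual with itself in direction \<open>h\<close> is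
  \<open>2 (A h) \<bullet> (A x - b)\<close>; moving \<open>A\<close> to the other factor as its transpose exhibits the gradient.
  In the separable sum each summand sees only its own coordinate of \<open>h\<close>.\<close>

lemma gderiv_least_squares_separable:
  fixes A :: "real ^ 'n ^ 'm"
  assumes "\<And>t. (\<phi> has_real_derivative \<phi>' t) (at t)"
  shows "GDERIV (\<lambda>x. (norm (A *v x - b))\<^sup>2 + c * (\<Sum>k\<in>UNIV. \<phi> (x $ k))) x :>
           2 *\<^sub>R (transpose A *v (A *v x - b)) + c *\<^sub>R (\<chi> k. \<phi>' (x $ k))"
proof -
  have "((\<lambda>x. (norm (A *v x - b))\<^sup>2 + c * (\<Sum>k\<in>UNIV. \<phi> (x $ k))) has_derivative
          (\<lambda>h. ((A *v x - b) \<bullet> (A *v h) + (A *v h) \<bullet> (A *v x - b))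
                + c * (\<Sum>k\<in>UNIV. \<phi>' (x $ k) * h $ k))) (at x)"
    unfolding power2_norm_eq_inner
    by (intro has_derivative_add has_derivative_inner has_derivative_residual
        has_derivative_mult_right has_derivative_sum has_derivative_component_compose assms)
  moreover have "(\<lambda>h. ((A *v x - b) \<bullet> (A *v h) + (A *v h) \<bullet> (A *v x - b))
                + c * (\<Sum>k\<in>UNIV. \<phi>' (x $ k) * h $ k))
      = (\<lambda>h. h \<bullet> (2 *\<^sub>R (transpose A *v (A *v x - b)) + c *\<^sub>R (\<chi> k. \<phi>' (x $ k))))"
  proof
    fix h
    have "(A *v h) \<bullet> (A *v x - b) = h \<bullet> (transpose A *v (A *v x - b))"
      by (metis dot_lmul_matrix inner_commute transpose_matrix_vector)
    moreover have "h \<bullet> (\<chi> k. \<phi>' (x $ k)) = (\<Sum>k\<in>UNIV. \<phi>' (x $ k) * h $ k)"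
      by (simp add: inner_vec_def mult.commute)
    ultimately show "((A *v x - b) \<bullet> (A *v h) + (A *v h) \<bullet> (A *v x - b))
                + c * (\<Sum>k\<in>UNIV. \<phi>' (x $ k) * h $ k)
        = h \<bullet> (2 *\<^sub>R (transpose A *v (A *v x - b)) + c *\<^sub>R (\<chi> k. \<phi>' (x $ k)))"
      by (simp add: inner_add_right inner_commute[of "A *v x - b"])
  qed
  ultimately show ?thesis
    by (simp add: gderiv_def)
qed

lemma Diag_mult_vec: "Diag a *v h = (\<chi> k. a $ k * h $ k)"
  by (simp add: vec_eq_iff matrix_vector_mult_def Diag_def if_distrib[of "\<lambda>z. z * _"] sum.delta
      cong: if_cong)

lemma Diag_scaleR: "r *\<^sub>R Diag a = Diag (r *\<^sub>R a)"
  by (simp add: vec_eq_iff Diag_def)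

text \<open>The gradient field is an affine map plus a map that acts on each coordinate separately;
  the latter has a diagonal Jacobian matrix.\<close>

lemma has_hessian_least_squares_separable:
  fixes A :: "real ^ 'n ^ 'm"
  assumes \<phi>: "\<And>t. (\<phi> has_real_derivative \<phi>' t) (at t)"
    and \<phi>': "\<And>t. (\<phi>' has_real_derivative \<phi>'' t) (at t)"
  shows "has_hessian (\<lambda>x. (norm (A *v x - b))\<^sup>2 + c * (\<Sum>k\<in>UNIV. \<phi> (x $ k)))
           (2 *\<^sub>R (transpose A ** A) + c *\<^sub>R Diag (\<chi> k. \<phi>'' (x $ k))) x"
proof -
  let ?g = "\<lambda>x. 2 *\<^sub>R (transpose A *v (A *v x - b)) + c *\<^sub>R (\<chi> k. \<phi>' (x $ k))"
  have "((\<lambda>x. \<chi> k. \<phi>' (x $ k)) has_derivative (\<lambda>h. \<chi> k. \<phi>'' (x $ k) * h $ k)) (at x)"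
    by (subst has_derivative_componentwise_within)
      (auto simp: Basis_vec_def inner_axis intro!: has_derivative_component_compose \<phi>')
  moreover have "((\<lambda>x. transpose A *v (A *v x - b)) has_derivative
      (\<lambda>h. transpose A *v (A *v h))) (at x)"
    by (rule bounded_linear.has_derivative[OF matrix_vector_mul_bounded_linear
          has_derivative_residual])
  ultimately have "(?g has_derivative
      (\<lambda>h. 2 *\<^sub>R (transpose A *v (A *v h)) + c *\<^sub>R (\<chi> k. \<phi>'' (x $ k) * h $ k))) (at x)"
    by (intro has_derivative_add has_derivative_scaleR_right)
  moreover have "(\<lambda>h. 2 *\<^sub>R (transpose A *v (A *v h)) + c *\<^sub>R (\<chi> k. \<phi>'' (x $ k) * h $ k))
      = (\<lambda>h. (2 *\<^sub>R (transpose A ** A) + c *\<^sub>R Diag (\<chi> k. \<phi>'' (x $ k))) *v h)"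
    by (simp add: matrix_vector_mult_add_rdistrib scaleR_matrix_vector_assoc[symmetric]
        Diag_mult_vec matrix_vector_mul_assoc)
  ultimately have "(?g has_derivative
      (\<lambda>h. (2 *\<^sub>R (transpose A ** A) + c *\<^sub>R Diag (\<chi> k. \<phi>'' (x $ k))) *v h)) (at x)"
    by simp
  then show ?thesis
    unfolding has_hessian_def
    by (intro exI[of _ ?g] conjI always_eventually allI gderiv_least_squares_separable \<phi>)
qed

theorem lemma3p1:
  fixes A :: "real ^ 'n ^ 'm" and b :: "real ^ 'm" and \<tau> \<sigma> :: real
  assumes "\<tau> > 0" and "\<sigma> > 0"
  shows "\<forall>x. GDERIV (H1 A b \<tau> \<sigma>) x :>
           (2 *\<^sub>R (transpose A *v (A *v x - b))
            + (2 * \<tau>) *\<^sub>R (\<chi> k. erf (x $ k / (sqrt 2 * \<sigma>))))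
       \<and> GDERIV (H1_tilde A b \<tau> \<sigma>) x :>
           (2 *\<^sub>R (transpose A *v (A *v x - b))
            + (2 * \<tau>) *\<^sub>R (\<chi> k. erf (x $ k / (sqrt 2 * \<sigma>))))
       \<and> GDERIV (H1_hat A b \<tau> \<sigma>) x :>
           (2 *\<^sub>R (transpose A *v (A *v x - b))
            + (2 * \<tau>) *\<^sub>R (\<chi> k. erf (x $ k / (sqrt 2 * \<sigma>))
                + x $ k * (1 / \<sigma>) * sqrt (2 / pi) * exp (- ((x $ k)\<^sup>2 / (2 * \<sigma>\<^sup>2)))))
       \<and> has_hessian (H1 A b \<tau> \<sigma>)
           (2 *\<^sub>R (transpose A ** A)
            + (2 * sqrt 2 * \<tau> / (\<sigma> * sqrt pi)) *\<^sub>R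
                Diag (\<chi> k. exp (- ((x $ k)\<^sup>2 / (2 * \<sigma>\<^sup>2))))) x
       \<and> has_hessian (H1_tilde A b \<tau> \<sigma>)
           (2 *\<^sub>R (transpose A ** A)
            + (2 * sqrt 2 * \<tau> / (\<sigma> * sqrt pi)) *\<^sub>R
                Diag (\<chi> k. exp (- ((x $ k)\<^sup>2 / (2 * \<sigma>\<^sup>2))))) x
       \<and> has_hessian (H1_hat A b \<tau> \<sigma>)
           (2 *\<^sub>R (transpose A ** A)
            + (4 * sqrt 2 * \<tau> / (\<sigma> * sqrt pi)) *\<^sub>R
                Diag (\<chi> k. exp (- ((x $ k)\<^sup>2 / (2 * \<sigma>\<^sup>2)))
                  - (x $ k)\<^sup>2 / (2 * \<sigma>\<^sup>2) * exp (- ((x $ k)\<^sup>2 / (2 * \<sigma>\<^sup>2))))) x"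
proof (intro allI conjI)
  fix x :: "real ^ 'n"
  let ?\<psi> = "\<lambda>t. erf (t / (sqrt 2 * \<sigma>))"
  let ?e = "\<lambda>t. exp (- (t\<^sup>2 / (2 * \<sigma>\<^sup>2)))"
  let ?G = "\<lambda>t. (1 / \<sigma>) * sqrt (2 / pi) * ?e t"
  let ?\<phi> = "\<lambda>t. t * ?\<psi> t + sqrt (2 / pi) * \<sigma> * ?e t"
  let ?\<phi>\<^sub>0 = "\<lambda>t. ?\<phi> t - sqrt (2 / pi) * \<sigma>"
  note \<psi>' = has_real_derivative_erf_scaled[OF \<open>\<sigma> > 0\<close>]
  note \<phi>' = has_real_derivative_smoothed_abs[OF \<open>\<sigma> > 0\<close>]
  note hat' = has_real_derivative_erf_penalty[OF \<open>\<sigma> > 0\<close>]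
  note hat'' = second_derivative_erf_penalty[OF \<open>\<sigma> > 0\<close>]
  have \<phi>\<^sub>0': "(?\<phi>\<^sub>0 has_real_derivative ?\<psi> t) (at t)" for t
    using DERIV_diff[OF \<phi>' DERIV_const] by simp
  have H1: "H1 A b \<tau> \<sigma> = (\<lambda>x. (norm (A *v x - b))\<^sup>2 + 2 * \<tau> * (\<Sum>k\<in>UNIV. ?\<phi> (x $ k)))"
    by (rule ext) (rule H1_def)
  have H1_tilde: "H1_tilde A b \<tau> \<sigma>
      = (\<lambda>x. (norm (A *v x - b))\<^sup>2 + 2 * \<tau> * (\<Sum>k\<in>UNIV. ?\<phi>\<^sub>0 (x $ k)))"
    by (rule ext) (rule H1_tilde_def)
  have H1_hat: "H1_hat A b \<tau> \<sigma>
      = (\<lambda>x. (norm (A *v x - b))\<^sup>2 + 2 * \<tau> * (\<Sum>k\<in>UNIV. x $ k * ?\<psi> (x $ k)))"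
    by (rule ext) (rule H1_hat_def)
  have const: "2 * \<tau> * ((1 / \<sigma>) * sqrt (2 / pi)) = 2 * sqrt 2 * \<tau> / (\<sigma> * sqrt pi)"
    by (simp add: real_sqrt_divide)
  have Diag: "(2 * \<tau>) *\<^sub>R Diag (\<chi> k. ?G (x $ k))
      = (2 * sqrt 2 * \<tau> / (\<sigma> * sqrt pi)) *\<^sub>R Diag (\<chi> k. ?e (x $ k))"
    unfolding Diag_scaleR const[symmetric] by (simp add: vec_eq_iff Diag_def)
  have Diag_hat: "(2 * \<tau>) *\<^sub>R Diag (\<chi> k. 2 * ((1 / \<sigma>) * sqrt (2 / pi)) * f k)
      = (4 * sqrt 2 * \<tau> / (\<sigma> * sqrt pi)) *\<^sub>R Diag (\<chi> k. f k)" for f :: "'n \<Rightarrow> real"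
    by (simp add: vec_eq_iff Diag_def real_sqrt_divide)
  show "GDERIV (H1 A b \<tau> \<sigma>) x :> (2 *\<^sub>R (transpose A *v (A *v x - b))
          + (2 * \<tau>) *\<^sub>R (\<chi> k. ?\<psi> (x $ k)))"
    unfolding H1 by (rule gderiv_least_squares_separable[OF \<phi>'])
  show "GDERIV (H1_tilde A b \<tau> \<sigma>) x :> (2 *\<^sub>R (transpose A *v (A *v x - b))
          + (2 * \<tau>) *\<^sub>R (\<chi> k. ?\<psi> (x $ k)))"
    unfolding H1_tilde by (rule gderiv_least_squares_separable[OF \<phi>\<^sub>0'])
  show "GDERIV (H1_hat A b \<tau> \<sigma>) x :> (2 *\<^sub>R (transpose A *v (A *v x - b))
          + (2 * \<tau>) *\<^sub>R (\<chi> k. ?\<psi> (x $ k) + x $ k * (1 / \<sigma>) * sqrt (2 / pi) * ?e (x $ k)))"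
    unfolding H1_hat by (rule gderiv_least_squares_separable[OF hat'])
  show "has_hessian (H1 A b \<tau> \<sigma>) (2 *\<^sub>R (transpose A ** A)
          + (2 * sqrt 2 * \<tau> / (\<sigma> * sqrt pi)) *\<^sub>R Diag (\<chi> k. ?e (x $ k))) x"
    unfolding H1 Diag[symmetric] by (rule has_hessian_least_squares_separable[OF \<phi>' \<psi>'])
  show "has_hessian (H1_tilde A b \<tau> \<sigma>) (2 *\<^sub>R (transpose A ** A)
          + (2 * sqrt 2 * \<tau> / (\<sigma> * sqrt pi)) *\<^sub>R Diag (\<chi> k. ?e (x $ k))) x"
    unfolding H1_tilde Diag[symmetric]
    by (rule has_hessian_least_squares_separable[OF \<phi>\<^sub>0' \<psi>'])
  show "has_hessian (H1_hat A b \<tau> \<sigma>) (2 *\<^sub>R (transpose A ** A)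
          + (4 * sqrt 2 * \<tau> / (\<sigma> * sqrt pi)) *\<^sub>R
              Diag (\<chi> k. ?e (x $ k) - (x $ k)\<^sup>2 / (2 * \<sigma>\<^sup>2) * ?e (x $ k))) x"
    unfolding H1_hat Diag_hat[symmetric]
    by (rule has_hessian_least_squares_separable[OF hat' hat''])
qed

end
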